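(* If $m\ge 2$, then $G\mathcal{W}(B_{\mathbb{B}_m})=\{t\in\mathbb{R}: t\ge 0\}$.
   Context: $\mathbb{B}_m$ is the Euclidean unit ball in $\mathbb{C}^m$ and $B_{\mathbb{B}_m}(z,w)=(1-\langle z,w\rangle)^{-(m+1)}$, $z,w\in\mathbb{B}_m$, is its Bergman kernel (with this normalization), where $\langle z,w\rangle=\sum_i z_i\bar w_i$. Real powers and the logarithm of $B_{\mathbb{B}_m}$ are taken using the principal branch of $\log(1-\langle z,w\rangle)$, i.e. $B_{\mathbb{B}_m}^t=\exp(-t(m+1)\log(1-\langle z,w\rangle))$. For a scalar sesqui-analytic non-negative definite kernel $K$ on $\Omega\times\Omega$ (with $K^t=\exp(t\log K)$ well defined for all $t\in\mathbb{R}$), the generalized Wallach set is $$G\mathcal{W}(K)=\Big\{t\in\mathbb{R}: K^t(z,w)\big((\partial_i\bar\partial_j\log K)(z,w)\big)_{i,j=1}^m\ \text{is non-negative definite on } \Omega\times\Omega\Big\},$$ where $\partial_i=\frac{\partial}{\partial z_i}$, $\bar\partial_j=\frac{\partial}{\partial\bar w_j}$. An $\mathcal{M}_m(\mathbb{C})$-valued function $L$ is non-negative definite if $\sum_{p,q=1}^n\langle L(z_p,z_q)\eta_q,\eta_p\rangle\ge0$ for all $n$, $z_1,\dots,z_n\in\Omega$, $\eta_1,\dots,\eta_n\in\mathbb{C}^m$. *)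

theory Defs
  imports "HOL-Complex_Analysis.Complex_Analysis"
begin

text \<open>
  The library's inner product on \<open>complex^'m\<close> is the real one, hence a separate Hermitian
  product; the library's norm and balls are the Euclidean ones.
\<close>

definition hinner :: "complex^'m \<Rightarrow> complex^'m \<Rightarrow> complex" where
  "hinner z w = (\<Sum>i\<in>UNIV. z $ i * cnj (w $ i))"

text \<open>Wirtinger derivatives in the \<open>i\<close>-th complex coordinate.\<close>

definition wirtinger :: "'m \<Rightarrow> (complex^'m \<Rightarrow> complex) \<Rightarrow> complex^'m \<Rightarrow> complex" where
  "wirtinger i f z =
     (vector_derivative (\<lambda>x. f (z + axis i (of_real x))) (at 0)
        - \<i> * vector_derivative (\<lambda>y. f (z + axis i (\<i> * of_real y))) (at 0)) / 2"

definition wirtinger_bar :: "'m \<Rightarrow> (complex^'m \<Rightarrow> complex) \<Rightarrow> complex^'m \<Rightarrow> complex" where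
  "wirtinger_bar i f z =
     (vector_derivative (\<lambda>x. f (z + axis i (of_real x))) (at 0)
        + \<i> * vector_derivative (\<lambda>y. f (z + axis i (\<i> * of_real y))) (at 0)) / 2"

text \<open>Membership in \<open>\<real>\<^sub>\<ge>\<^sub>0\<close> says that the complex sum is real and nonnegative.\<close>

definition nonneg_definite ::
  "(complex^'m) set \<Rightarrow> (complex^'m \<Rightarrow> complex^'m \<Rightarrow> complex^'m^'m) \<Rightarrow> bool" where
  "nonneg_definite \<Omega> L \<longleftrightarrow>
     (\<forall>n (z :: nat \<Rightarrow> complex^'m) (\<eta> :: nat \<Rightarrow> complex^'m). (\<forall>p\<in>{1..n}. z p \<in> \<Omega>) \<longrightarrow>
        (\<Sum>p=1..n. \<Sum>q=1..n. hinner (L (z p) (z q) *v \<eta> q) (\<eta> p)) \<in> \<real>\<^sub>\<ge>\<^sub>0)"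

text \<open>
  A power \<open>K\<^sup>t = exp (t log K)\<close> depends on the branch of \<open>log K\<close>. A kernel therefore enters the next
  two definitions through its chosen logarithm \<open>\<Lambda> = log K\<close>, a function on \<open>\<Omega> \<times> \<Omega>\<close> that is
  holomorphic in the first and antiholomorphic in the second argument, with \<open>exp \<Lambda> = K\<close>.
\<close>

definition kernel_power ::
  "(complex^'m \<Rightarrow> complex^'m \<Rightarrow> complex) \<Rightarrow> real \<Rightarrow> complex^'m \<Rightarrow> complex^'m \<Rightarrow> complex" where
  "kernel_power \<Lambda> t z w = exp (of_real t * \<Lambda> z w)"

definition gen_wallach_set ::
  "(complex^'m) set \<Rightarrow> (complex^'m \<Rightarrow> complex^'m \<Rightarrow> complex) \<Rightarrow> real set" where
  "gen_wallach_set \<Omega> \<Lambda> =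
     {t. nonneg_definite \<Omega> (\<lambda>z w. \<chi> i j.
           kernel_power \<Lambda> t z w * wirtinger i (\<lambda>z'. wirtinger_bar j (\<Lambda> z') w) z)}"

definition bergman_ball :: "complex^'m \<Rightarrow> complex^'m \<Rightarrow> complex" where
  "bergman_ball z w = (1 - hinner z w) powi (- (int CARD('m) + 1))"

text \<open>
  On the ball, \<open>Re (1 - hinner z w) > 0\<close>, so the principal branch \<^const>\<open>Ln\<close> is analytic there.
  This need not be the principal logarithm of the value \<open>bergman_ball z w\<close>.
\<close>

definition log_bergman_ball :: "complex^'m \<Rightarrow> complex^'m \<Rightarrow> complex" where
  "log_bergman_ball z w = - of_nat (CARD('m) + 1) * Ln (1 - hinner z w)"

lemma norm_hinner_le: "norm (hinner z w) \<le> norm z * norm w"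
proof -
  have "norm (hinner z w) \<le> (\<Sum>i\<in>UNIV. \<bar>norm (z $ i)\<bar> * \<bar>norm (w $ i)\<bar>)"
    unfolding hinner_def by (rule order_trans[OF norm_sum]) (simp add: norm_mult)
  also have "\<dots> \<le> norm z * norm w"
    unfolding norm_vec_def by (rule L2_set_mult_ineq)
  finally show ?thesis .
qed

lemma Re_one_minus_hinner_pos:
  assumes "z \<in> ball 0 1" "w \<in> ball 0 1"
  shows "0 < Re (1 - hinner z w)"
proof -
  have "norm z * norm w < 1 * 1"
    using assms by (intro mult_strict_mono') auto
  then have "norm (hinner z w) < 1"
    using norm_hinner_le[of z w] by simp
  then show ?thesis
    using complex_Re_le_cmod[of "hinner z w"] by simp
qed

lemma kernel_power_log_bergman_ball:
  fixes z w :: "complex^'m"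
  assumes "z \<in> ball 0 1" "w \<in> ball 0 1"
  shows "kernel_power log_bergman_ball 1 z w = bergman_ball z w"
proof -
  have "1 - hinner z w \<noteq> 0"
    using Re_one_minus_hinner_pos[OF assms] by auto
  then have "exp (of_nat (CARD('m) + 1) * Ln (1 - hinner z w)) = (1 - hinner z w) ^ (CARD('m) + 1)"
    by (simp only: exp_of_nat_mult exp_Ln not_False_eq_True)
  moreover have "- (int CARD('m) + 1) = - int (CARD('m) + 1)"
    by simp
  ultimately show ?thesis
    unfolding kernel_power_def log_bergman_ball_def bergman_ball_def
    by (simp only: of_real_1 mult_1 mult_minus_left exp_minus power_int_minus power_int_of_nat)
qed

end

theory Submission
  imports Defs
begin

text \<open>
  Write \<open>s = \<langle>z, w\<rangle>\<close> and \<open>\<alpha> = t (m + 1)\<close>. Differentiating \<open>- (m + 1) Ln (1 - s)\<close> gives the matrix with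
  entries \<open>(m + 1) (\<delta>\<^sub>i\<^sub>j / (1 - s) + z\<^sub>j cnj w\<^sub>i / (1 - s)\<^sup>2)\<close>. It is multiplied by
  \<open>(1 - s) powr (- \<alpha>)\<close>. With \<open>y\<close> the complex conjugate of the test vector \<open>\<eta>\<close>, the form to be examined is therefore, up to the factor \<open>m + 1\<close>, the sum over
  pairs of points \<open>p, q\<close> of
  \<open>(1 - s) powr (- (\<alpha> + 1)) * \<langle>y\<^sub>p, y\<^sub>q\<rangle> + (1 - s) powr (- (\<alpha> + 2)) * \<langle>y\<^sub>p, z\<^sub>q\<rangle> \<langle>z\<^sub>p, y\<^sub>q\<rangle>\<close> with \<open>s = \<langle>z\<^sub>p, z\<^sub>q\<rangle>\<close>.

  Positivity for \<open>t \<ge> 0\<close>. Put \<open>a = \<alpha> + 1 \<ge> 1\<close>. By the binomial series, the summand is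
  \<open>\<Sum>n. (a)\<^sub>n / n! \<cdot> (s\<^sup>n E + (n / a) s\<^sup>n\<^sup>-\<^sup>1 V)\<close> with \<open>E = \<langle>y\<^sub>p, y\<^sub>q\<rangle>\<close> and
  \<open>V = \<langle>y\<^sub>p, z\<^sub>q\<rangle> \<langle>z\<^sub>p, y\<^sub>q\<rangle>\<close>. Each bracket is the convex combination with weights \<open>1 - 1/a\<close> and
  \<open>1/a\<close> of two nonnegative definite kernels: \<open>s\<^sup>n E\<close> is the Gram kernel of \<open>z\<^sup>\<otimes>\<^sup>n \<otimes> y\<close>
  (\<open>power_kernel_nonneg\<close>), and \<open>s\<^sup>n E + n s\<^sup>n\<^sup>-\<^sup>1 V\<close> is, up to the factor \<open>n + 1\<close>, the Gram kernel of
  the derivative of \<open>z \<mapsto> z\<^sup>\<otimes>\<^sup>n\<^sup>+\<^sup>1\<close> in direction \<open>y\<close> (\<open>derivative_kernel_nonneg\<close>). The weights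
  are nonnegative because \<open>t \<ge> 0\<close> gives \<open>a \<ge> 1\<close>.

  Failure for \<open>t < 0\<close>. The term of the series that is of first order in \<open>s\<close> is \<open>a s E + V\<close>. Exchanging
  the two tensor factors turns the Gram kernel \<open>s E\<close> of \<open>z \<otimes> y\<close> into \<open>V\<close>, so on antisymmetric tensors
  this term acts as \<open>a - 1 = \<alpha>\<close>. As \<open>m \<ge> 2\<close>, there are nonzero antisymmetric tensors
  \<open>e\<^sub>i \<otimes> e\<^sub>j - e\<^sub>j \<otimes> e\<^sub>i\<close>; using the points \<open>\<plusminus>\<epsilon> e\<^sub>i\<close>, \<open>\<plusminus>\<epsilon> e\<^sub>j\<close> with opposite test vectors cancels the term of
  order zero. With \<open>x = \<epsilon>\<^sup>2\<close> the form is then \<open>4 ((1 - x) powr (- a) - (1 + x) powr (- a)) - 8 x\<close>, which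
  is \<open>8 \<alpha> x\<close> to first order and thus negative for small \<open>x\<close>.
\<close>

unbundle no fps_syntax

section \<open>Gram kernels of tensor powers and of their derivatives\<close>

definition conj_vec :: "complex^'m \<Rightarrow> complex^'m" where
  "conj_vec x = (\<chi> i. cnj (x $ i))"

lemma sum_in_nonneg_Reals:
  fixes f :: "'a \<Rightarrow> complex"
  shows "(\<And>x. x \<in> A \<Longrightarrow> f x \<in> \<real>\<^sub>\<ge>\<^sub>0) \<Longrightarrow> sum f A \<in> \<real>\<^sub>\<ge>\<^sub>0"
  by (induction A rule: infinite_finite_induct) (auto intro: nonneg_Reals_add_I)

lemma gram_sum_nonneg:
  fixes c :: "'a \<Rightarrow> complex"
  shows "(\<Sum>p\<in>A. \<Sum>q\<in>A. c p * cnj (c q)) \<in> \<real>\<^sub>\<ge>\<^sub>0"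
proof -
  have "(\<Sum>p\<in>A. \<Sum>q\<in>A. c p * cnj (c q)) = (\<Sum>p\<in>A. c p) * cnj (\<Sum>q\<in>A. c q)"
    by (simp add: sum_product cnj_sum)
  then show ?thesis
    by (simp only: complex_norm_square[symmetric]) (simp add: complex_nonneg_Reals_iff)
qed

lemma sum_swap_innermost:
  "(\<Sum>p\<in>A. \<Sum>q\<in>A. \<Sum>i\<in>I. f p q i) = (\<Sum>i\<in>I. \<Sum>p\<in>A. \<Sum>q\<in>A. f p q i)"
  by (simp add: sum.swap[of _ I])

text \<open>
  Expanding one factor \<open>s = \<Sum>i. z\<^sub>p\<^sub>i cnj z\<^sub>q\<^sub>i\<close> absorbs the coordinate \<open>i\<close> into the coefficients; the
  coefficients \<open>d\<close> are arbitrary to let the induction on \<open>k\<close> run.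
\<close>
lemma power_kernel_nonneg:
  fixes z y :: "'a \<Rightarrow> complex^'m"
  shows "(\<Sum>p\<in>A. \<Sum>q\<in>A. hinner (z p) (z q) ^ k * hinner (y p) (y q) * (d p * cnj (d q))) \<in> \<real>\<^sub>\<ge>\<^sub>0"
proof (induction k arbitrary: d)
  case 0
  have "(\<Sum>p\<in>A. \<Sum>q\<in>A. hinner (y p) (y q) * (d p * cnj (d q)))
      = (\<Sum>i\<in>UNIV. \<Sum>p\<in>A. \<Sum>q\<in>A. (d p * y p $ i) * cnj (d q * y q $ i))"
    unfolding sum_swap_innermost[symmetric]
    by (intro sum.cong refl) (simp add: hinner_def sum_distrib_left sum_distrib_right mult_ac)
  then show ?case
    by (simp only: power_0 mult_1) (intro sum_in_nonneg_Reals gram_sum_nonneg)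
next
  case (Suc k)
  have "(\<Sum>p\<in>A. \<Sum>q\<in>A. hinner (z p) (z q) ^ Suc k * hinner (y p) (y q) * (d p * cnj (d q)))
      = (\<Sum>i\<in>UNIV. \<Sum>p\<in>A. \<Sum>q\<in>A. hinner (z p) (z q) ^ k * hinner (y p) (y q) *
           ((d p * z p $ i) * cnj (d q * z q $ i)))"
    unfolding sum_swap_innermost[symmetric]
  proof (intro sum.cong refl)
    fix p q
    show "hinner (z p) (z q) ^ Suc k * hinner (y p) (y q) * (d p * cnj (d q)) =
       (\<Sum>i\<in>UNIV. hinner (z p) (z q) ^ k * hinner (y p) (y q) * (d p * z p $ i * cnj (d q * z q $ i)))"
      unfolding sum_distrib_left[symmetric]
      by (simp add: hinner_def[of "z p" "z q"] sum_distrib_left sum_distrib_right mult_ac)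
  qed
  also have "\<dots> \<in> \<real>\<^sub>\<ge>\<^sub>0"
    by (intro sum_in_nonneg_Reals Suc.IH)
  finally show ?case .
qed

text \<open>
  Let \<open>\<phi>(z) = z\<^sup>\<otimes>\<^sup>k\<close> and let \<open>D\<^sub>y \<phi>\<close> be its derivative in direction \<open>y\<close>. For \<open>s = \<langle>z, z'\<rangle>\<close>,
  \<open>v = \<langle>y, z'\<rangle>\<close>, \<open>w = \<langle>z, y'\<rangle>\<close>, \<open>e = \<langle>y, y'\<rangle>\<close> and \<open>C\<close>, \<open>D\<close> the conjugates of \<open>c'\<close>, \<open>d'\<close>, this is the
  inner product of \<open>c \<phi>(z) + d D\<^sub>y \<phi>(z)\<close> with \<open>c' \<phi>(z') + d' D\<^sub>y\<^sub>' \<phi>(z')\<close>. The truncated exponents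
  \<open>k - 1\<close> and \<open>k - 2\<close> occur with coefficient zero whenever they are not the true ones.
\<close>
definition jet_form ::
  "nat \<Rightarrow> complex \<Rightarrow> complex \<Rightarrow> complex \<Rightarrow> complex \<Rightarrow> complex \<Rightarrow> complex \<Rightarrow> complex \<Rightarrow> complex \<Rightarrow> complex" where
  "jet_form k s v w e c d C D =
     s ^ k * (c * C) + of_nat k * s ^ (k - 1) * (v * (d * C) + w * (c * D))
       + (of_nat k * s ^ (k - 1) * e + of_nat (k * (k - 1)) * s ^ (k - 2) * (v * w)) * (d * D)"

text \<open>
  The product rule for the \<open>i\<close>-th block \<open>z\<^sub>i \<phi>(z)\<close> of \<open>z \<otimes> \<phi>(z)\<close>: its derivative is
  \<open>z\<^sub>i D\<^sub>y \<phi>(z) + y\<^sub>i \<phi>(z)\<close>, so the coefficients \<open>(c, d)\<close> become \<open>(c z\<^sub>i + d y\<^sub>i, d z\<^sub>i)\<close>.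
\<close>
lemma jet_form_Suc:
  fixes z y z' y' :: "complex^'m"
  shows "jet_form (Suc k) (hinner z z') (hinner y z') (hinner z y') (hinner y y') c d (cnj C) (cnj D)
    = (\<Sum>i\<in>UNIV. jet_form k (hinner z z') (hinner y z') (hinner z y') (hinner y y')
        (c * z $ i + d * y $ i) (d * z $ i) (cnj (C * z' $ i + D * y' $ i)) (cnj (D * z' $ i)))"
proof -
  define s v w e where defs: "s = hinner z z'" "v = hinner y z'" "w = hinner z y'" "e = hinner y y'"
  have 1: "(\<Sum>i\<in>UNIV. (c * z $ i + d * y $ i) * cnj (C * z' $ i + D * y' $ i))
      = c * cnj C * s + c * cnj D * w + d * cnj C * v + d * cnj D * e"
    by (simp add: defs hinner_def sum_distrib_left sum.distrib algebra_simps)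
  have 2: "(\<Sum>i\<in>UNIV. (d * z $ i) * cnj (C * z' $ i + D * y' $ i)) = d * cnj C * s + d * cnj D * w"
    by (simp add: defs hinner_def sum_distrib_left sum.distrib algebra_simps)
  have 3: "(\<Sum>i\<in>UNIV. (c * z $ i + d * y $ i) * cnj (D * z' $ i)) = c * cnj D * s + d * cnj D * v"
    by (simp add: defs hinner_def sum_distrib_left sum.distrib algebra_simps)
  have 4: "(\<Sum>i\<in>UNIV. (d * z $ i) * cnj (D * z' $ i)) = d * cnj D * s"
    by (simp add: defs hinner_def sum_distrib_left algebra_simps)
  have "jet_form (Suc k) s v w e c d (cnj C) (cnj D) =
     s ^ k * (c * cnj C * s + c * cnj D * w + d * cnj C * v + d * cnj D * e)
     + of_nat k * s ^ (k - 1) * (v * (d * cnj C * s + d * cnj D * w) + w * (c * cnj D * s + d * cnj D * v))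
     + (of_nat k * s ^ (k - 1) * e + of_nat (k * (k - 1)) * s ^ (k - 2) * (v * w)) * (d * cnj D * s)"
  proof -
    consider "k = 0" | "k = 1" | j where "k = Suc (Suc j)"
      by (metis One_nat_def not0_implies_Suc)
    then show ?thesis
      by cases (simp_all add: jet_form_def algebra_simps power2_eq_square)
  qed
  also have "\<dots> = (\<Sum>i\<in>UNIV. jet_form k s v w e
        (c * z $ i + d * y $ i) (d * z $ i) (cnj (C * z' $ i + D * y' $ i)) (cnj (D * z' $ i)))"
    unfolding jet_form_def sum.distrib sum_distrib_left[symmetric] 1 2 3 4 by (rule refl)
  finally show ?thesis unfolding defs .
qed

lemma jet_form_nonneg:
  fixes z y :: "'a \<Rightarrow> complex^'m"
  shows "(\<Sum>p\<in>A. \<Sum>q\<in>A. jet_form k (hinner (z p) (z q)) (hinner (y p) (z q)) (hinner (z p) (y q))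
           (hinner (y p) (y q)) (c p) (d p) (cnj (c q)) (cnj (d q))) \<in> \<real>\<^sub>\<ge>\<^sub>0"
proof (induction k arbitrary: c d)
  case 0
  then show ?case using gram_sum_nonneg[of c A] by (simp add: jet_form_def)
next
  case (Suc k)
  show ?case
    unfolding jet_form_Suc sum_swap_innermost by (intro sum_in_nonneg_Reals Suc.IH)
qed

text \<open>
  The case of pure derivatives: with \<open>c = 0\<close>, \<open>d = 1\<close> and degree \<open>k + 1\<close>, the jet form is \<open>k + 1\<close> times
  the present summand.
\<close>
lemma derivative_kernel_nonneg:
  fixes z y :: "'a \<Rightarrow> complex^'m"
  shows "(\<Sum>p\<in>A. \<Sum>q\<in>A. hinner (z p) (z q) ^ k * hinner (y p) (y q)
      + of_nat k * hinner (z p) (z q) ^ (k - 1) * (hinner (y p) (z q) * hinner (z p) (y q))) \<in> \<real>\<^sub>\<ge>\<^sub>0"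
    (is "?S \<in> _")
proof -
  have "of_nat (Suc k) * ?S \<in> \<real>\<^sub>\<ge>\<^sub>0"
    using jet_form_nonneg[where k = "Suc k" and c = "\<lambda>_. 0" and d = "\<lambda>_. 1" and A = A and z = z and y = y]
    by (simp add: jet_form_def sum_distrib_left algebra_simps)
  then have "inverse (of_nat (Suc k)) * (of_nat (Suc k) * ?S) \<in> \<real>\<^sub>\<ge>\<^sub>0"
    by (rule nonneg_Reals_mult_I[rotated]) (simp only: nonneg_Reals_of_nat_I nonneg_Reals_inverse_I)
  moreover have "inverse (of_nat (Suc k)) * (of_nat (Suc k) * ?S) = ?S"
  proof -
    have "inverse c * (c * x) = x" if "c \<noteq> 0" for c x :: complex
      using that by simp
    from this[OF of_nat_neq_0] show ?thesis .
  qed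
  ultimately show ?thesis by (simp only:)
qed

section \<open>The mixed derivative of the logarithm of the Bergman kernel\<close>

lemma hinner_add_axis:
  fixes z w :: "complex^'m"
  shows "hinner (z + axis i a) w = hinner z w + a * cnj (w $ i)"
    and "hinner z (w + axis i a) = hinner z w + z $ i * cnj a"
  by (simp_all add: hinner_def axis_def distrib_right distrib_left sum.distrib if_distrib[of cnj]
      if_distrib[of "\<lambda>x. x * _"] if_distrib[of "\<lambda>x. _ * x"] cong: if_cong)

lemma one_minus_hinner_slit:
  assumes "z \<in> ball 0 1" "w \<in> ball 0 1"
  shows "1 - hinner z w \<notin> \<real>\<^sub>\<le>\<^sub>0"
  using Re_one_minus_hinner_pos[OF assms] by (auto simp: complex_nonpos_Reals_iff)

text \<open>
  If the derivative along the line \<open>u e\<^sub>j\<close> depends antilinearly on \<open>u\<close>, then the Wirtinger combination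
  of the directions \<open>u = 1\<close> and \<open>u = \<i>\<close> returns the coefficient; linear dependence is the counterpart
  for the holomorphic derivative.
\<close>
lemma wirtinger_bar_eqI:
  assumes "\<And>u. vector_derivative (\<lambda>x. f (w + axis j (u * of_real x))) (at 0) = cnj u * D"
  shows "wirtinger_bar j f w = D"
  using assms[of 1] assms[of \<i>] by (simp add: wirtinger_bar_def mult.assoc[symmetric])

lemma wirtinger_eqI:
  assumes "\<And>u. vector_derivative (\<lambda>x. f (z + axis i (u * of_real x))) (at 0) = u * D"
  shows "wirtinger i f z = D"
  using assms[of 1] assms[of \<i>] by (simp add: wirtinger_def mult.assoc[symmetric])

lemma wirtinger_bar_log_bergman_ball:
  fixes z w :: "complex^'m"
  assumes "z \<in> ball 0 1" "w \<in> ball 0 1"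
  shows "wirtinger_bar j (log_bergman_ball z) w = of_nat (CARD('m) + 1) * z $ j / (1 - hinner z w)"
proof (intro wirtinger_bar_eqI vector_derivative_at)
  fix u
  have "((\<lambda>x. - of_nat (CARD('m) + 1) * Ln (1 - (hinner z w + z $ j * (cnj u * x))))
      has_field_derivative cnj u * (of_nat (CARD('m) + 1) * z $ j / (1 - hinner z w)))
      (at (of_real 0))"
    using one_minus_hinner_slit[OF assms]
    by (auto intro!: derivative_eq_intros simp: divide_inverse algebra_simps)
  from has_vector_derivative_real_field[OF this]
  show "((\<lambda>x. log_bergman_ball z (w + axis j (u * of_real x))) has_vector_derivative
      cnj u * (of_nat (CARD('m) + 1) * z $ j / (1 - hinner z w))) (at 0)"
    by (simp only: log_bergman_ball_def hinner_add_axis complex_cnj_mult complex_cnj_complex_of_real)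
qed

lemma has_field_derivative_linear_fraction:
  fixes a b d r :: complex
  assumes "r \<noteq> 0"
  shows "((\<lambda>x. (a + b * x) / (r - d * x)) has_field_derivative b / r + a * d / r ^ 2) (at 0)"
  using assms by (auto intro!: derivative_eq_intros simp: field_simps power2_eq_square)

lemma wirtinger_wirtinger_bar_log_bergman_ball:
  fixes z w :: "complex^'m"
  assumes z: "z \<in> ball 0 1" and w: "w \<in> ball 0 1"
  shows "wirtinger i (\<lambda>z'. wirtinger_bar j (log_bergman_ball z') w) z =
    of_nat (CARD('m) + 1) * ((if i = j then 1 else 0) / (1 - hinner z w)
      + z $ j * cnj (w $ i) / (1 - hinner z w) ^ 2)" (is "_ = ?c * ?R")
proof (intro wirtinger_eqI vector_derivative_at)
  fix u
  have nz: "1 - hinner z w \<noteq> 0"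
    using one_minus_hinner_slit[OF assms] by auto
  \<comment> \<open>The inner derivative is known only for points of the ball, hence only for small \<open>x\<close>.\<close>
  define S where "S = (\<lambda>x::real. z + axis i (u * of_real x)) -` ball 0 1"
  have cont: "continuous_on UNIV (\<lambda>x::real. z + axis i (u * of_real x))"
    unfolding axis_def
    by (intro continuous_intros continuous_on_vec_lambda, rename_tac l, case_tac "l = i")
      (auto intro!: continuous_intros)
  have axis_0: "axis i (0::complex) = 0"
    by (simp add: axis_def vec_eq_iff)
  have coord: "(z + axis i a) $ j = z $ j + (if i = j then a else 0)" for a
    by (simp add: axis_def)
  have S: "open S" "0 \<in> S"
    unfolding S_def using z by (auto intro!: open_vimage cont simp: axis_0)
  have "((\<lambda>x. ?c * ((z $ j + (if i = j then u else 0) * x)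
       / ((1 - hinner z w) - (u * cnj (w $ i)) * x))) has_field_derivative u * (?c * ?R)) (at (of_real 0))"
    using DERIV_cmult[OF has_field_derivative_linear_fraction[OF nz,
      of "z $ j" "if i = j then u else 0" "u * cnj (w $ i)"], of ?c]
    by (cases "i = j") (simp_all add: distrib_left mult_ac)
  from has_vector_derivative_real_field[OF this]
  show "((\<lambda>x. wirtinger_bar j (log_bergman_ball (z + axis i (u * of_real x))) w)
      has_vector_derivative u * (?c * ?R)) (at 0)"
  proof (rule has_vector_derivative_transform_within_open[OF _ S])
    fix x assume "x \<in> S"
    then show "?c * ((z $ j + (if i = j then u else 0) * of_real x)
         / ((1 - hinner z w) - (u * cnj (w $ i)) * of_real x))
      = wirtinger_bar j (log_bergman_ball (z + axis i (u * of_real x))) w"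
      using w coord[of "u * of_real x"]
      by (cases "i = j")
        (simp_all add: S_def wirtinger_bar_log_bergman_ball hinner_add_axis diff_diff_eq mult_ac)
  qed
qed

text \<open>
  Conjugating the test vectors turns both summands into products of Hermitian products, so that the
  Gram kernels above apply.
\<close>
lemma bergman_curvature_form:
  fixes z w x y :: "complex^'m" and t :: real
  assumes z: "z \<in> ball 0 1" and w: "w \<in> ball 0 1"
  defines "\<alpha> \<equiv> t * (real CARD('m) + 1)"
  shows "hinner ((\<chi> i j. kernel_power log_bergman_ball t z w *
        wirtinger i (\<lambda>z'. wirtinger_bar j (log_bergman_ball z') w) z) *v y) x
    = of_nat (CARD('m) + 1) *
       ((1 - hinner z w) powr (- of_real (\<alpha> + 1)) * hinner (conj_vec x) (conj_vec y)
        + (1 - hinner z w) powr (- of_real (\<alpha> + 2)) *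
            (hinner (conj_vec x) w * hinner z (conj_vec y)))"
proof -
  define r where "r = 1 - hinner z w"
  define c where "c = (of_nat (CARD('m) + 1) :: complex)"
  have nz: "r \<noteq> 0"
    using one_minus_hinner_slit[OF assms(1,2)] by (auto simp: r_def)
  define k where "k = r powr (- of_real \<alpha>)"
  have k: "kernel_power log_bergman_ball t z w = k"
    using nz by (simp add: kernel_power_def log_bergman_ball_def k_def powr_def \<alpha>_def flip: r_def)
      (simp add: algebra_simps)
  have k1: "r powr (- of_real (\<alpha> + 1)) = k / r"
    using nz powr_diff[of r "- of_real \<alpha>" 1] by (simp add: k_def)
  have k2: "r powr (- of_real (\<alpha> + 2)) = k / r ^ 2"
  proof -
    have "- complex_of_real (\<alpha> + 2) = - of_real \<alpha> - of_nat 2"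
      by simp
    then show ?thesis
      using nz by (simp only: powr_diff powr_nat k_def if_False)
  qed
  have "hinner ((\<chi> i j. k * (c * ((if i = j then 1 else 0) / r + z $ j * cnj (w $ i) / r ^ 2))) *v y) x
     = (\<Sum>i\<in>UNIV. \<Sum>j\<in>UNIV. k * (c * ((if i = j then 1 else 0) / r + z $ j * cnj (w $ i) / r ^ 2)) * y $ j * cnj (x $ i))"
    by (simp add: hinner_def matrix_vector_mult_def sum_distrib_right)
  also have "\<dots> = (\<Sum>i\<in>UNIV. \<Sum>j\<in>UNIV. (if i = j then c * k / r * y $ j * cnj (x $ i) else 0)) +
      c * k / r ^ 2 * (\<Sum>i\<in>UNIV. \<Sum>j\<in>UNIV. (cnj (x $ i) * cnj (w $ i)) * (z $ j * y $ j))"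
    unfolding sum_distrib_left sum.distrib[symmetric]
    using nz by (intro sum.cong refl) (simp add: divide_simps, simp add: algebra_simps)
  also have "\<dots> = c * (k / r * hinner (conj_vec x) (conj_vec y)
        + k / r ^ 2 * (hinner (conj_vec x) w * hinner z (conj_vec y)))"
  proof -
    have 1: "(\<Sum>i\<in>UNIV. \<Sum>j\<in>UNIV. if i = j then c * k / r * y $ j * cnj (x $ i) else 0)
        = c * k / r * hinner (conj_vec x) (conj_vec y)"
      by (simp add: hinner_def conj_vec_def sum_distrib_left mult_ac)
    have 2: "(\<Sum>i\<in>UNIV. \<Sum>j\<in>UNIV. (cnj (x $ i) * cnj (w $ i)) * (z $ j * y $ j))
        = hinner (conj_vec x) w * hinner z (conj_vec y)"
      by (simp add: hinner_def conj_vec_def sum_product)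
    show ?thesis
      unfolding 1 2 by (simp add: distrib_left mult.assoc)
  qed
  finally show ?thesis
    unfolding wirtinger_wirtinger_bar_log_bergman_ball[OF assms(1,2)] k
    by (simp only: r_def[symmetric] c_def[symmetric] k1 k2)
qed

section \<open>Nonnegativity for nonnegative exponents\<close>

lemma powr_neg_one_minus_sums:
  fixes s :: complex
  assumes "norm s < 1"
  shows "(\<lambda>n. of_real (pochhammer a n / fact n) * s ^ n) sums (1 - s) powr (- of_real a)"
proof -
  have "((- of_real a) gchoose n) * (- s) ^ n = of_real (pochhammer a n / fact n) * s ^ n" for n
  proof -
    have "((- of_real a) gchoose n) * (- s) ^ n
        = ((- 1) ^ n * (- 1) ^ n) * (pochhammer (of_real a) n / fact n) * s ^ n"
      unfolding gbinomial_pochhammer power_minus[of s] minus_minus by simp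
    also have "\<dots> = of_real (pochhammer a n / fact n) * s ^ n"
      by (simp add: pochhammer_of_real)
    finally show ?thesis .
  qed
  then show ?thesis
    using gen_binomial_complex[of "- s" "- of_real a"] assms by simp
qed

text \<open>
  The series for the exponent \<open>a + 1\<close>, written with the coefficients for \<open>a\<close> by means of
  \<open>a (a + 1)\<^sub>n = (a)\<^sub>n\<^sub>+\<^sub>1\<close>. The index is shifted by one, with a vanishing term at \<open>n = 0\<close>, so that it
  can be added termwise to the series for the exponent \<open>a\<close>.
\<close>
lemma powr_neg_one_minus_sums_shift:
  fixes s :: complex
  assumes "norm s < 1" and a: "a > 0"
  shows "(\<lambda>n. of_real (pochhammer a n / fact n) * (of_nat n / of_real a * s ^ (n - 1)))
     sums (1 - s) powr (- of_real (a + 1))"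
proof -
  have "of_real (pochhammer (a + 1) n / fact n) * s ^ n =
     of_real (pochhammer a (Suc n) / fact (Suc n)) * (of_nat (Suc n) / of_real a * s ^ (Suc n - 1))" for n
  proof -
    have "pochhammer (a + 1) n / fact n = pochhammer a (Suc n) / fact (Suc n) * (real (Suc n) / a)"
      using a by (simp add: pochhammer_rec field_simps del: of_nat_Suc)
    then show ?thesis
      by (metis (no_types, lifting) diff_Suc_1 mult.assoc of_real_divide of_real_mult of_real_of_nat_eq)
  qed
  then show ?thesis
    using powr_neg_one_minus_sums[OF assms(1), of "a + 1"]
      sums_Suc_iff[of "\<lambda>n. of_real (pochhammer a n / fact n) * (of_nat n / of_real a * s ^ (n - 1))"]
    by simp
qed

text \<open>
  The \<open>n\<close>-th terms of the two binomial series combine to a nonnegative multiple of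
  \<open>s\<^sup>n E + (n / a) s\<^sup>n\<^sup>-\<^sup>1 V = (1 - 1/a) s\<^sup>n E + (1/a) (s\<^sup>n E + n s\<^sup>n\<^sup>-\<^sup>1 V)\<close>, and nonnegativity passes
  to the limit. The condition \<open>a \<ge> 1\<close> makes both weights nonnegative.
\<close>
lemma curvature_kernel_nonneg:
  fixes z y :: "'a \<Rightarrow> complex^'m"
  assumes z: "\<And>p. p \<in> A \<Longrightarrow> z p \<in> ball 0 1" and a: "a \<ge> 1"
  shows "(\<Sum>p\<in>A. \<Sum>q\<in>A.
       (1 - hinner (z p) (z q)) powr (- of_real a) * hinner (y p) (y q)
     + (1 - hinner (z p) (z q)) powr (- of_real (a + 1)) * (hinner (y p) (z q) * hinner (z p) (y q)))
     \<in> \<real>\<^sub>\<ge>\<^sub>0" (is "?S \<in> _")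
proof -
  define E where "E p q = hinner (y p) (y q)" for p q
  define V where "V p q = hinner (y p) (z q) * hinner (z p) (y q)" for p q
  define s where "s p q = hinner (z p) (z q)" for p q
  define F where "F n = (\<Sum>p\<in>A. \<Sum>q\<in>A. of_real (pochhammer a n / fact n) *
      (s p q ^ n * E p q + of_nat n / of_real a * s p q ^ (n - 1) * V p q))" for n
  have norm: "norm (s p q) < 1" if "p \<in> A" "q \<in> A" for p q
    using norm_hinner_le[of "z p" "z q"] z[OF that(1)] z[OF that(2)]
      mult_strict_mono'[of "norm (z p)" 1 "norm (z q)" 1] by (simp add: s_def)
  have "(\<lambda>n. of_real (pochhammer a n / fact n) *
      (s p q ^ n * E p q + of_nat n / of_real a * s p q ^ (n - 1) * V p q)) sums
      ((1 - s p q) powr (- of_real a) * E p q + (1 - s p q) powr (- of_real (a + 1)) * V p q)"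
    if "p \<in> A" "q \<in> A" for p q
    using sums_add[OF sums_mult2[OF powr_neg_one_minus_sums[OF norm[OF that], of a], of "E p q"]
      sums_mult2[OF powr_neg_one_minus_sums_shift[OF norm[OF that], of a], of "V p q"]] a
    by (simp add: distrib_left mult.assoc)
  then have "F sums ?S"
    unfolding F_def by (fold s_def E_def V_def) (intro sums_sum)
  moreover have "F n \<in> \<real>\<^sub>\<ge>\<^sub>0" for n
  proof -
    let ?P = "\<Sum>p\<in>A. \<Sum>q\<in>A. s p q ^ n * E p q"
    let ?D = "\<Sum>p\<in>A. \<Sum>q\<in>A. s p q ^ n * E p q + of_nat n * s p q ^ (n - 1) * V p q"
    have "F n = of_real (pochhammer a n / fact n) * (of_real (1 - 1 / a) * ?P + of_real (1 / a) * ?D)"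
      unfolding F_def sum_distrib_left sum.distrib[symmetric]
      using a by (intro sum.cong refl) (simp add: field_simps)
    moreover have "?P \<in> \<real>\<^sub>\<ge>\<^sub>0"
      using power_kernel_nonneg[where d = "\<lambda>_. 1" and z = z and y = y and A = A and k = n]
      by (simp add: s_def E_def)
    moreover have "?D \<in> \<real>\<^sub>\<ge>\<^sub>0"
      unfolding s_def E_def V_def by (rule derivative_kernel_nonneg)
    moreover have "pochhammer a n \<ge> 0"
      using a by (intro less_imp_le pochhammer_pos) simp
    ultimately show ?thesis
      using a by (simp only: nonneg_Reals_mult_I nonneg_Reals_add_I nonneg_Reals_of_real_iff
          divide_nonneg_nonneg fact_ge_zero diff_ge_0_iff_ge divide_le_eq_1_pos zero_le_one)
  qed
  ultimately show ?thesis
    unfolding sums_def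
    by (intro Lim_in_closed_set[OF closed_nonneg_Reals_complex, of "\<lambda>n. sum F {..<n}" sequentially])
      (auto intro!: always_eventually sum_in_nonneg_Reals)
qed

section \<open>Failure for negative exponents\<close>

text \<open>
  The difference of the two sides vanishes at \<open>0\<close> and has derivative \<open>2 (l + 1) - 2 = 2 l < 0\<close> there.
\<close>
lemma powr_difference_less_linear:
  assumes "l < (0::real)"
  shows "\<exists>x. 0 < x \<and> x < 1 \<and> (1 - x) powr (- (l + 1)) - (1 + x) powr (- (l + 1)) < 2 * x"
proof -
  define g where "g x = (1 - x) powr (- (l + 1)) - (1 + x) powr (- (l + 1)) - 2 * x" for x
  have "(g has_real_derivative 2 * l) (at 0)"
    unfolding g_def by (auto intro!: derivative_eq_intros)
  from DERIV_neg_dec_right[OF this] assms obtain d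
    where d: "d > 0" "\<And>h. 0 < h \<Longrightarrow> h < d \<Longrightarrow> g (0 + h) < g 0" by auto
  have "g (min d 1 / 2) < 0"
    using d(2)[of "min d 1 / 2"] d(1) by (simp add: g_def)
  then show ?thesis
    using d(1) by (intro exI[of _ "min d 1 / 2"]) (auto simp: g_def)
qed

lemma hinner_axis: "hinner (axis i a) (axis j b) = (if i = j then a * cnj b else 0)"
  by (auto simp: hinner_def axis_def if_distrib[of cnj] if_distrib[of "\<lambda>x. x * _"]
      if_distrib[of "\<lambda>x. _ * x"] cong: if_cong)

lemma conj_vec_axis: "conj_vec (axis i a) = axis i (cnj a)"
  by (auto simp: conj_vec_def axis_def vec_eq_iff)

lemma norm_axis_complex: "norm (axis i (a :: complex)) = norm a"
proof -
  have "(norm (axis i a))\<^sup>2 = (norm a)\<^sup>2"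
    by (simp add: power2_norm_eq_inner inner_axis_axis)
  then show ?thesis
    by simp
qed

text \<open>
  The points \<open>1\<close> and \<open>2\<close> build the antisymmetric tensor \<open>\<epsilon> (e\<^sub>i \<otimes> e\<^sub>j - e\<^sub>j \<otimes> e\<^sub>i)\<close>. The points \<open>3\<close> and \<open>4\<close>
  are their negatives with negated test vectors: they contribute the same tensor again, while the test
  vectors now add up to zero. Of the sixteen pairs, those with \<open>z\<^sub>p = \<plusminus>z\<^sub>q\<close> contribute the
  \<open>powr\<close> terms, and the eight orthogonal ones contribute \<open>- x\<close> each.
\<close>
lemma curvature_form_antisymmetric_test:
  fixes i j :: "'m::finite" and x b :: real and z y :: "nat \<Rightarrow> complex^'m"
  assumes "i \<noteq> j" and x: "0 < x" "x < 1"
    and \<epsilon>: "\<epsilon> = complex_of_real (sqrt x)"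
    and z: "z = (\<lambda>p. if p = 1 then axis i \<epsilon> else if p = 2 then axis j \<epsilon>
                  else if p = 3 then axis i (- \<epsilon>) else axis j (- \<epsilon>))"
    and y: "y = (\<lambda>p. if p = 1 then axis j 1 else if p = 2 then axis i (- 1)
                  else if p = 3 then axis j (- 1) else axis i 1)"
  shows "(\<Sum>p=1..4. \<Sum>q=1..4.
       (1 - hinner (z p) (z q)) powr (- of_real b) * hinner (y p) (y q)
     + (1 - hinner (z p) (z q)) powr (- of_real (b + 1)) * (hinner (y p) (z q) * hinner (z p) (y q)))
     = of_real (4 * ((1 - x) powr (- b) - (1 + x) powr (- b)) - 8 * x)"
proof -
  have eps: "\<epsilon> * \<epsilon> = of_real x" "cnj \<epsilon> = \<epsilon>"
    using x by (simp_all add: \<epsilon> flip: of_real_mult)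
  have A: "{1..4::nat} = {1, 2, 3, 4}"
    by auto
  have "of_real (1 - x) powr (of_real (- b) :: complex) = of_real ((1 - x) powr (- b))"
    "of_real (1 + x) powr (of_real (- b) :: complex) = of_real ((1 + x) powr (- b))"
    using x by (intro powr_of_real; simp)+
  then have P: "(1 - of_real x) powr (- of_real b :: complex) = of_real ((1 - x) powr (- b))"
    "(1 + of_real x) powr (- of_real b :: complex) = of_real ((1 + x) powr (- b))"
    by simp_all
  show ?thesis
    using assms(1) unfolding A z y by (simp add: hinner_axis eps P)
qed

theorem theorem5p4:
  assumes "CARD('m::finite) \<ge> 2"
  shows "gen_wallach_set (ball 0 1) (log_bergman_ball :: complex^'m \<Rightarrow> complex^'m \<Rightarrow> complex)
           = {t. t \<ge> 0}"
proof -
  define L :: "real \<Rightarrow> complex^'m \<Rightarrow> complex^'m \<Rightarrow> complex^'m^'m" where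
    "L t z w = (\<chi> i j. kernel_power log_bergman_ball t z w *
       wirtinger i (\<lambda>z'. wirtinger_bar j (log_bergman_ball z') w) z)" for t z w
  define b where "b t = t * (real CARD('m) + 1) + 1" for t
  have form: "(\<Sum>p=1..n. \<Sum>q=1..n. hinner (L t (z p) (z q) *v \<eta> q) (\<eta> p)) =
      of_nat (CARD('m) + 1) * (\<Sum>p=1..n. \<Sum>q=1..n.
       (1 - hinner (z p) (z q)) powr (- of_real (b t)) * hinner (conj_vec (\<eta> p)) (conj_vec (\<eta> q))
     + (1 - hinner (z p) (z q)) powr (- of_real (b t + 1)) *
         (hinner (conj_vec (\<eta> p)) (z q) * hinner (z p) (conj_vec (\<eta> q))))"
    if z: "\<forall>p\<in>{1..n}. z p \<in> ball 0 1" for n t and z \<eta> :: "nat \<Rightarrow> complex^'m"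
  proof -
    have b1: "b t + 1 = t * (real CARD('m) + 1) + 2"
      by (simp add: b_def)
    show ?thesis
      unfolding sum_distrib_left b1 unfolding b_def L_def
      by (intro sum.cong refl bergman_curvature_form z[rule_format])
  qed
  have "nonneg_definite (ball 0 1) (L t) \<longleftrightarrow> t \<ge> 0" for t
  proof
    assume t: "t \<ge> 0"
    show "nonneg_definite (ball 0 1) (L t)"
      unfolding nonneg_definite_def
    proof (intro allI impI)
      fix n and z \<eta> :: "nat \<Rightarrow> complex^'m"
      assume z: "\<forall>p\<in>{1..n}. z p \<in> ball 0 1"
      have "b t \<ge> 1"
        using t by (simp add: b_def)
      then show "(\<Sum>p=1..n. \<Sum>q=1..n. hinner (L t (z p) (z q) *v \<eta> q) (\<eta> p)) \<in> \<real>\<^sub>\<ge>\<^sub>0"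
        unfolding form[OF z]
        by (intro nonneg_Reals_mult_I nonneg_Reals_of_nat_I curvature_kernel_nonneg z[rule_format])
    qed
  next
    assume psd: "nonneg_definite (ball 0 1) (L t)"
    show "t \<ge> 0"
    proof (rule ccontr)
      assume "\<not> t \<ge> 0"
      then have "t * (real CARD('m) + 1) < 0"
        by (simp add: mult_less_0_iff)
      from powr_difference_less_linear[OF this] obtain x
        where x: "0 < x" "x < 1" and neg: "(1 - x) powr (- b t) - (1 + x) powr (- b t) < 2 * x"
        by (auto simp: b_def)
      obtain i j :: 'm where ij: "i \<noteq> j"
        using assms by (metis (full_types) UNIV_I card_le_Suc0_iff_eq finite_code not_less_eq_eq numeral_2_eq_2)
      define \<epsilon> where "\<epsilon> = complex_of_real (sqrt x)"
      define z where "z = (\<lambda>p::nat. if p = 1 then axis i \<epsilon> else if p = 2 then axis j \<epsilon>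
          else if p = 3 then axis i (- \<epsilon>) else axis j (- \<epsilon>))"
      define \<eta> where "\<eta> = (\<lambda>p::nat. if p = 1 then axis j 1 else if p = 2 then axis i (- 1)
          else if p = 3 then axis j (- 1) else axis i (1 :: complex))"
      have z: "\<forall>p\<in>{1..4}. z p \<in> ball 0 1"
        using x by (simp add: z_def \<epsilon>_def norm_axis_complex)
      have \<eta>: "conj_vec (\<eta> p) = \<eta> p" for p
        by (simp add: \<eta>_def conj_vec_axis)
      define R where "R = 4 * ((1 - x) powr (- b t) - (1 + x) powr (- b t)) - 8 * x"
      have "(\<Sum>p=1..4. \<Sum>q=1..4. hinner (L t (z p) (z q) *v \<eta> q) (\<eta> p))
          = of_nat (CARD('m) + 1) * of_real R"
        unfolding form[OF z] \<eta> R_def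
        by (subst curvature_form_antisymmetric_test[OF ij x \<epsilon>_def z_def \<eta>_def]) (rule refl)
      moreover have "(\<Sum>p=1..4. \<Sum>q=1..4. hinner (L t (z p) (z q) *v \<eta> q) (\<eta> p)) \<in> \<real>\<^sub>\<ge>\<^sub>0"
        using psd z unfolding nonneg_definite_def by blast
      moreover have "of_nat (CARD('m) + 1) * of_real R = complex_of_real (real (CARD('m) + 1) * R)"
        by simp
      ultimately have "0 \<le> real (CARD('m) + 1) * R"
        by (simp only: nonneg_Reals_of_real_iff)
      then have "0 \<le> R"
        by (simp only: zero_le_mult_iff) auto
      then show False
        using neg by (simp add: R_def)
    qed
  qed
  then show ?thesis
    unfolding gen_wallach_set_def by (simp add: L_def[abs_def])
qed

end
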